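(* Fix $r\in\mathbb{N}$ and let $\mathcal{A}$ and $\mathcal{B}$ be two sets of finite $\tau$-structures. The following are equivalent: (a) Duplicator wins the $r$-round MS game on $(\mathcal{A},\mathcal{B})$; (b) Duplicator wins the $r$-round MS game without duplicating on $(\mathcal{A}^+,\mathcal{B}^+)$, where $\mathcal{A}^+$ is the multiset consisting of $|A|^r$ copies of each $\mathbf{A}\in\mathcal{A}$ (with $A$ the universe of $\mathbf{A}$) and $\mathcal{B}^+$ is the multiset consisting of $|B|^r$ copies of each $\mathbf{B}\in\mathcal{B}$.
   Context: Fix a schema $\tau$ with finitely many relation and constant symbols. A pebbled structure $\langle \mathbf{A} \mid a_1,\dots,a_t\rangle$ is a $\tau$-structure with elements $a_1,\dots,a_t$ (not necessarily distinct), $a_i$ carrying pebble color $i$. Two pebbled structures $\langle \mathbf{A}\mid a_1,\dots,a_t\rangle$, $\langle \mathbf{B}\mid b_1,\dots,b_t\rangle$ form a matching pair if the map $a_i\mapsto b_i$, $c^{\mathbf{A}}\mapsto c^{\mathbf{B}}$ (for constant symbols $c$) is an isomorphism between the substructures induced by its domain and range. The $r$-round MS game on $(\mathcal{A},\mathcal{B})$: start at $(\mathcal{A}_0,\mathcal{B}_0)=(\mathcal{A},\mathcal{B})$; if no left/right matching pair exists, Spoiler wins. In round $t=1,\dots,r$ Spoiler chooses a side, say left (right is symmetric), and places pebble $t$ on an element of each pebbled structure in $\mathcal{A}_{t-1}$, giving $\mathcal{A}_t$; Duplicator, for each pebbled structure in $\mathcal{B}_{t-1}$, may make any number of copies and places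 pebble $t$ on an element of each copy, giving $\mathcal{B}_t$. If no member of $\mathcal{A}_t$ forms a matching pair with a member of $\mathcal{B}_t$, Spoiler wins. Duplicator wins if a matching pair remains after round $r$. The game "without duplicating" on multisets is the same game except that Duplicator may not make copies: she places exactly one pebble on each (copy of a) pebbled structure on her side. "Wins" means has a winning strategy. *)

theory Defs
  imports Main
begin

record ('r, 'c) schema =
  rel_syms :: "'r set"
  const_syms :: "'c set"
  arity :: "'r \<Rightarrow> nat"

definition finite_schema :: "('r, 'c) schema \<Rightarrow> bool" where
  "finite_schema \<tau> \<longleftrightarrow> finite (rel_syms \<tau>) \<and> finite (const_syms \<tau>)"

record ('r, 'c, 'a) struct =
  univ :: "'a set"
  rel :: "'r \<Rightarrow> 'a list set"
  con :: "'c \<Rightarrow> 'a"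

text \<open>The interpretation of symbols outside the schema is fixed to a dummy value, so that two
  structures are equal iff they agree on their universe and on the symbols of the schema.\<close>

definition is_structure :: "('r, 'c) schema \<Rightarrow> ('r, 'c, 'a) struct \<Rightarrow> bool" where
  "is_structure \<tau> A \<longleftrightarrow>
     univ A \<noteq> {} \<and>
     (\<forall>R\<in>rel_syms \<tau>. rel A R \<subseteq> {xs. set xs \<subseteq> univ A \<and> length xs = arity \<tau> R}) \<and>
     (\<forall>c\<in>const_syms \<tau>. con A c \<in> univ A) \<and>
     (\<forall>R. R \<notin> rel_syms \<tau> \<longrightarrow> rel A R = {}) \<and>
     (\<forall>c. c \<notin> const_syms \<tau> \<longrightarrow> con A c = undefined)"

definition finite_structure :: "('r, 'c) schema \<Rightarrow> ('r, 'c, 'a) struct \<Rightarrow> bool" where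
  "finite_structure \<tau> A \<longleftrightarrow> is_structure \<tau> A \<and> finite (univ A)"

definition induced :: "('r, 'c, 'a) struct \<Rightarrow> 'a set \<Rightarrow> ('r, 'c, 'a) struct" where
  "induced A D = \<lparr>univ = D, rel = (\<lambda>R. {xs \<in> rel A R. set xs \<subseteq> D}), con = con A\<rparr>"

definition isomorphism ::
  "('r, 'c) schema \<Rightarrow> ('a \<Rightarrow> 'b) \<Rightarrow> ('r, 'c, 'a) struct \<Rightarrow> ('r, 'c, 'b) struct \<Rightarrow> bool" where
  "isomorphism \<tau> h A B \<longleftrightarrow>
     bij_betw h (univ A) (univ B) \<and>
     (\<forall>R\<in>rel_syms \<tau>. \<forall>xs. set xs \<subseteq> univ A \<and> length xs = arity \<tau> R \<longrightarrow>
        (xs \<in> rel A R \<longleftrightarrow> map h xs \<in> rel B R)) \<and>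
     (\<forall>c\<in>const_syms \<tau>. h (con A c) = con B c)"

text \<open>In \<open>(A, as)\<close> pebble \<open>i\<close> (counted from 1) lies on the element \<open>as ! (i - 1)\<close>.\<close>

type_synonym ('r, 'c, 'a) pebbled = "('r, 'c, 'a) struct \<times> 'a list"

definition place :: "'a \<Rightarrow> ('r, 'c, 'a) pebbled \<Rightarrow> ('r, 'c, 'a) pebbled" where
  "place a p = (fst p, snd p @ [a])"

definition matching_pair ::
  "('r, 'c) schema \<Rightarrow> ('r, 'c, 'a) pebbled \<Rightarrow> ('r, 'c, 'a) pebbled \<Rightarrow> bool" where
  "matching_pair \<tau> p q \<longleftrightarrow>
     (case (p, q) of ((A, as), (B, bs)) \<Rightarrow>
        \<exists>h. map h as = bs \<and> (\<forall>c\<in>const_syms \<tau>. h (con A c) = con B c) \<and>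
            isomorphism \<tau> h
              (induced A (set as \<union> con A ` const_syms \<tau>))
              (induced B (set bs \<union> con B ` const_syms \<tau>)))"

definition matching_exists ::
  "('r, 'c) schema \<Rightarrow> ('r, 'c, 'a) pebbled set \<times> ('r, 'c, 'a) pebbled set \<Rightarrow> bool" where
  "matching_exists \<tau> pos \<longleftrightarrow> (\<exists>p\<in>fst pos. \<exists>q\<in>snd pos. matching_pair \<tau> p q)"

text \<open>An \<open>r\<close>-round game in which each round consists of a Spoiler step \<open>S\<close> from a position to an
  intermediate position followed by a Duplicator step \<open>D\<close> to the next position; Spoiler wins as
  soon as a position violates \<open>alive\<close>. A Duplicator strategy \<open>\<sigma>\<close> maps the list of intermediate
  positions so far (Spoiler's moves) to the next position. It is winning if, whenever the first
  \<open>n \<le> r\<close> rounds are played according to it against legal Spoiler moves \<open>Q\<close>, its own moves were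
  legal and the position reached is alive.\<close>

definition duplicator_wins ::
  "('p \<Rightarrow> 'q \<Rightarrow> bool) \<Rightarrow> ('q \<Rightarrow> 'p \<Rightarrow> bool) \<Rightarrow> ('p \<Rightarrow> bool) \<Rightarrow> nat \<Rightarrow> 'p \<Rightarrow> bool" where
  "duplicator_wins S D alive r p0 \<longleftrightarrow>
     (\<exists>\<sigma> :: 'q list \<Rightarrow> 'p. \<forall>n\<le>r. \<forall>P Q.
        P 0 = p0 \<and> (\<forall>t<n. S (P t) (Q t) \<and> P (Suc t) = \<sigma> (map Q [0..<Suc t])) \<longrightarrow>
        (\<forall>t<n. D (Q t) (P (Suc t))) \<and> alive (P n))"

datatype side = Left | Right

fun spoiler_step ::
  "('x \<Rightarrow> 'x \<Rightarrow> bool) \<Rightarrow> 'x \<times> 'x \<Rightarrow> side \<times> 'x \<times> 'x \<Rightarrow> bool" where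
  "spoiler_step move (X, Y) (Left, X', Y') \<longleftrightarrow> move X X' \<and> Y' = Y"
| "spoiler_step move (X, Y) (Right, X', Y') \<longleftrightarrow> X' = X \<and> move Y Y'"

fun duplicator_step ::
  "('x \<Rightarrow> 'x \<Rightarrow> bool) \<Rightarrow> side \<times> 'x \<times> 'x \<Rightarrow> 'x \<times> 'x \<Rightarrow> bool" where
  "duplicator_step move (Left, X, Y) (X', Y') \<longleftrightarrow> X' = X \<and> move Y Y'"
| "duplicator_step move (Right, X, Y) (X', Y') \<longleftrightarrow> move X X' \<and> Y' = Y"

definition place_each ::
  "('r, 'c, 'a) pebbled set \<Rightarrow> ('r, 'c, 'a) pebbled set \<Rightarrow> bool" where
  "place_each X X' \<longleftrightarrow>
     (\<exists>f. (\<forall>p\<in>X. f p \<in> univ (fst p)) \<and> X' = (\<lambda>p. place (f p) p) ` X)"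

text \<open>\<open>G p\<close> is the set of elements on which the new pebble is placed in \<open>p\<close> and its copies.\<close>

definition copy_and_place ::
  "('r, 'c, 'a) pebbled set \<Rightarrow> ('r, 'c, 'a) pebbled set \<Rightarrow> bool" where
  "copy_and_place X X' \<longleftrightarrow>
     (\<exists>G. (\<forall>p\<in>X. G p \<noteq> {} \<and> G p \<subseteq> univ (fst p)) \<and>
          X' = {place a p | p a. p \<in> X \<and> a \<in> G p})"

definition duplicator_wins_MS ::
  "('r, 'c) schema \<Rightarrow> nat \<Rightarrow> ('r, 'c, 'a) struct set \<Rightarrow> ('r, 'c, 'a) struct set \<Rightarrow> bool" where
  "duplicator_wins_MS \<tau> r \<A> \<B> \<longleftrightarrow>
     duplicator_wins (spoiler_step place_each) (duplicator_step copy_and_place)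
       (matching_exists \<tau>) r ((\<lambda>A. (A, [])) ` \<A>, (\<lambda>B. (B, [])) ` \<B>)"

text \<open>A multiset is represented by a set of pairs \<open>(x, k)\<close>, the tag \<open>k\<close> telling apart the copies
  of \<open>x\<close>; unlike the type \<open>multiset\<close> this allows infinitely many different elements. Tags never
  change during the game, so distinct copies stay distinct.\<close>

definition place_each_copy ::
  "(('r, 'c, 'a) pebbled \<times> nat) set \<Rightarrow> (('r, 'c, 'a) pebbled \<times> nat) set \<Rightarrow> bool" where
  "place_each_copy M M' \<longleftrightarrow>
     (\<exists>f. (\<forall>(p, k)\<in>M. f (p, k) \<in> univ (fst p)) \<and>
          M' = (\<lambda>(p, k). (place (f (p, k)) p, k)) ` M)"

definition duplicator_wins_nodup ::
  "('r, 'c) schema \<Rightarrow> nat \<Rightarrow> (('r, 'c, 'a) struct \<times> nat) set \<Rightarrow>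
     (('r, 'c, 'a) struct \<times> nat) set \<Rightarrow> bool" where
  "duplicator_wins_nodup \<tau> r M N \<longleftrightarrow>
     duplicator_wins (spoiler_step place_each_copy) (duplicator_step place_each_copy)
       (\<lambda>(X, Y). matching_exists \<tau> (fst ` X, fst ` Y)) r
       ((\<lambda>(A, k). ((A, []), k)) ` M, (\<lambda>(B, k). ((B, []), k)) ` N)"

definition copies :: "nat \<Rightarrow> ('r, 'c, 'a) struct set \<Rightarrow> (('r, 'c, 'a) struct \<times> nat) set" where
  "copies r \<A> = {(A, k). A \<in> \<A> \<and> k < card (univ A) ^ r}"

end

theory Submission
  imports Defs
begin

text \<open>If Duplicator wins without duplicating, she wins the MS game by placing her pebble in all
  possible ways, while Spoiler's moves are repeated uniformly on all copies. Conversely, with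
  \<open>s\<close> rounds left the game on multisets simulates an MS position in which every pebbled structure
  over \<open>A\<close> is represented by at least \<open>|A| ^ s\<close> copies: when Spoiler moves, some element of \<open>A\<close> is
  chosen in at least a fraction \<open>1 / |A|\<close> of these copies, and this is read as Spoiler's MS move;
  when Duplicator moves, she distributes the copies evenly over the elements of \<open>A\<close>.\<close>

section \<open>Games one round at a time, and transfer of wins between games\<close>

lemma duplicator_wins_0: "duplicator_wins S D alive 0 p \<longleftrightarrow> alive p"
  unfolding duplicator_wins_def by auto

text \<open>Strategies read the whole history, while inductions on the number of rounds work with
  positions only. A strategy splits at Spoiler's first move; conversely, the replies and later
  strategies selected for each first move are glued into one strategy.\<close>

lemma duplicator_wins_Suc:
  "duplicator_wins S D alive (Suc r) p \<longleftrightarrow>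
     alive p \<and> (\<forall>q. S p q \<longrightarrow> (\<exists>p'. D q p' \<and> duplicator_wins S D alive r p'))"
    (is "?L \<longleftrightarrow> ?R")
proof
  assume ?L
  then obtain \<sigma> where \<sigma>: "\<And>n P Q. \<lbrakk>n \<le> Suc r; P 0 = p;
        \<forall>t<n. S (P t) (Q t) \<and> P (Suc t) = \<sigma> (map Q [0..<Suc t])\<rbrakk>
      \<Longrightarrow> (\<forall>t<n. D (Q t) (P (Suc t))) \<and> alive (P n)"
    unfolding duplicator_wins_def by blast
  have "D q (\<sigma> [q]) \<and> duplicator_wins S D alive r (\<sigma> [q])" if "S p q" for q
  proof
    show "D q (\<sigma> [q])"
      using \<sigma>[of 1 "case_nat p (\<lambda>_. \<sigma> [q])" "\<lambda>_. q"] that by simp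
    show "duplicator_wins S D alive r (\<sigma> [q])"
      unfolding duplicator_wins_def
    proof (intro exI[of _ "\<lambda>qs. \<sigma> (q # qs)"] allI impI)
      fix n P Q
      assume n: "n \<le> r" and play: "P 0 = \<sigma> [q] \<and>
        (\<forall>t<n. S (P t) (Q t) \<and> P (Suc t) = \<sigma> (q # map Q [0..<Suc t]))"
      \<comment> \<open>The play after the first round is shifted by one: \<open>case_nat\<close>
        puts \<open>p\<close> and \<open>q\<close> in front, giving a play of the original game that
        follows \<open>\<sigma>\<close>.\<close>
      have "S (case_nat p P t) (case_nat q Q t) \<and>
          case_nat p P (Suc t) = \<sigma> (map (case_nat q Q) [0..<Suc t])" if "t < Suc n" for t
        using play that \<open>S p q\<close> by (cases t) (simp_all add: map_upt_Suc del: upt_Suc)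
      then have *: "(\<forall>t<Suc n. D (case_nat q Q t) (case_nat p P (Suc t)))
          \<and> alive (case_nat p P (Suc n))"
        using \<sigma>[of "Suc n" "case_nat p P" "case_nat q Q"] n by simp
      have "D (Q t) (P (Suc t))" if "t < n" for t
        using *[THEN conjunct1, rule_format, of "Suc t"] that by simp
      then show "(\<forall>t<n. D (Q t) (P (Suc t))) \<and> alive (P n)"
        using * by simp
    qed
  qed
  moreover have "alive p"
    using \<sigma>[of 0 "\<lambda>_. p"] by simp
  ultimately show ?R by blast
next
  assume R: ?R
  then obtain g where g: "\<And>q. S p q \<Longrightarrow> D q (g q) \<and> duplicator_wins S D alive r (g q)"
    by metis
  then have "\<forall>q. \<exists>\<sigma>. S p q \<longrightarrow> (\<forall>n\<le>r. \<forall>P Q. P 0 = g q \<and>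
        (\<forall>t<n. S (P t) (Q t) \<and> P (Suc t) = \<sigma> (map Q [0..<Suc t])) \<longrightarrow>
        (\<forall>t<n. D (Q t) (P (Suc t))) \<and> alive (P n))"
    unfolding duplicator_wins_def by blast
  then obtain \<sigma> where \<sigma>: "\<And>q n P Q. \<lbrakk>S p q; n \<le> r; P 0 = g q;
        \<forall>t<n. S (P t) (Q t) \<and> P (Suc t) = \<sigma> q (map Q [0..<Suc t])\<rbrakk> \<Longrightarrow>
        (\<forall>t<n. D (Q t) (P (Suc t))) \<and> alive (P n)"
    by metis
  \<comment> \<open>A history of length one is answered by \<open>g\<close>; a longer one is passed,
    without its first move, to the strategy selected for that move.\<close>
  define \<rho> where "\<rho> = (\<lambda>qs. if tl qs = [] then g (hd qs) else \<sigma> (hd qs) (tl qs))"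
  show ?L
    unfolding duplicator_wins_def
  proof (intro exI[of _ \<rho>] allI impI)
    fix n P Q
    assume n: "n \<le> Suc r" and play: "P 0 = p \<and>
        (\<forall>t<n. S (P t) (Q t) \<and> P (Suc t) = \<rho> (map Q [0..<Suc t]))"
    show "(\<forall>t<n. D (Q t) (P (Suc t))) \<and> alive (P n)"
    proof (cases n)
      case 0
      then show ?thesis using R play by simp
    next
      case (Suc m)
      have P1: "P (Suc 0) = g (Q 0)" and S0: "S p (Q 0)"
        using play Suc by (auto simp: \<rho>_def)
      have "S (P (Suc t)) (Q (Suc t)) \<and>
          P (Suc (Suc t)) = \<sigma> (Q 0) (map (\<lambda>i. Q (Suc i)) [0..<Suc t])" if "t < m" for t
      proof -
        have "S (P (Suc t)) (Q (Suc t)) \<and> P (Suc (Suc t)) = \<rho> (map Q [0..<Suc (Suc t)])"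
          using play Suc that by blast
        then show ?thesis
          by (simp add: \<rho>_def map_upt_Suc del: upt_Suc)
      qed
      then have *: "(\<forall>t<m. D (Q (Suc t)) (P (Suc (Suc t)))) \<and> alive (P (Suc m))"
        using \<sigma>[OF S0, of m "\<lambda>i. P (Suc i)" "\<lambda>i. Q (Suc i)"] n Suc P1 by simp
      have "D (Q t) (P (Suc t))" if "t < n" for t
        using that * g[OF S0] P1 Suc by (cases t) auto
      then show ?thesis using * Suc by simp
    qed
  qed
qed

text \<open>Here \<open>E s X M\<close> relates one side of the two games when \<open>s\<close> rounds are left.\<close>

lemma duplicator_wins_transfer:
  assumes spoiler: "\<And>s X M M'. \<lbrakk>E (Suc s) X M; mS' M M'\<rbrakk> \<Longrightarrow> \<exists>X'. mS X X' \<and> E s X' M'"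
    and duplicator: "\<And>s X M X'. \<lbrakk>E (Suc s) X M; mD X X'\<rbrakk> \<Longrightarrow> \<exists>M'. mD' M M' \<and> E s X' M'"
    and alive: "\<And>s X Y M N. \<lbrakk>E s X M; E s Y N; alive (X, Y)\<rbrakk> \<Longrightarrow> alive' (M, N)"
    and "E r X M" "E r Y N"
    and "duplicator_wins (spoiler_step mS) (duplicator_step mD) alive r (X, Y)"
  shows "duplicator_wins (spoiler_step mS') (duplicator_step mD') alive' r (M, N)"
  using assms(4-)
proof (induction r arbitrary: X Y M N)
  case 0
  then show ?case by (auto simp: duplicator_wins_0 intro: alive)
next
  case (Suc r)
  have win: "\<exists>p'. duplicator_step mD q p' \<and>
      duplicator_wins (spoiler_step mS) (duplicator_step mD) alive r p'"
    if "spoiler_step mS (X, Y) q" for q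
    using Suc.prems(3) that unfolding duplicator_wins_Suc by blast
  have "\<exists>p'. duplicator_step mD' q p' \<and>
      duplicator_wins (spoiler_step mS') (duplicator_step mD') alive' r p'"
    if q: "spoiler_step mS' (M, N) q" for q
  proof -
    obtain d M1 N1 where q_eq: "q = (d, M1, N1)" by (cases q)
    show ?thesis
    proof (cases d)
      case Left
      with q q_eq have "mS' M M1" and N1: "N1 = N" by auto
      \<comment> \<open>Spoiler's move is pulled back to the first game, Duplicator's winning reply
        is found there, and the reply is pushed forward.\<close>
      then obtain X' where X': "mS X X'" "E r X' M1"
        using spoiler Suc.prems(1) by blast
      then obtain Y' where Y': "mD Y Y'"
          "duplicator_wins (spoiler_step mS) (duplicator_step mD) alive r (X', Y')"
        using win[of "(Left, X', Y)"] by auto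
      then obtain N' where "mD' N N'" "E r Y' N'"
        using duplicator Suc.prems(2) by blast
      then show ?thesis
        using Suc.IH[OF X'(2) _ Y'(2), of N'] q_eq Left N1
        by (intro exI[of _ "(M1, N')"]) auto
    next
      case Right
      with q q_eq have "mS' N N1" and M1: "M1 = M" by auto
      then obtain Y' where Y': "mS Y Y'" "E r Y' N1"
        using spoiler Suc.prems(2) by blast
      then obtain X' where X': "mD X X'"
          "duplicator_wins (spoiler_step mS) (duplicator_step mD) alive r (X', Y')"
        using win[of "(Right, X, Y')"] by auto
      then obtain M' where "mD' M M'" "E r X' M'"
        using duplicator Suc.prems(1) by blast
      then show ?thesis
        using Suc.IH[OF _ Y'(2) X'(2), of M'] q_eq Right M1
        by (intro exI[of _ "(M', N1)"]) auto
    qed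
  qed
  moreover have "alive' (M, N)"
    using alive[OF Suc.prems(1,2)] Suc.prems(3) by (simp add: duplicator_wins_Suc)
  ultimately show ?case by (simp add: duplicator_wins_Suc)
qed

section \<open>Two counting lemmas\<close>

text \<open>Pigeonhole principle: if all fibres had fewer than \<open>n\<close> points, they could
  not add up to \<open>card U * n\<close>.\<close>

lemma large_fibre_exists:
  assumes "finite K" "finite U" "U \<noteq> {}" "f ` K \<subseteq> U" "card U * n \<le> card K"
  shows "\<exists>a\<in>U. n \<le> card {k \<in> K. f k = a}"
proof (rule ccontr)
  assume *: "\<not> ?thesis"
  have "card K = (\<Sum>a\<in>U. card {k \<in> K. f k = a})"
    using sum.group[OF assms(1,2,4), of "\<lambda>_. 1::nat"] by simp
  also have "\<dots> < (\<Sum>a\<in>U. n)"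
    using * assms by (intro sum_strict_mono) auto
  finally show False using assms by simp
qed

text \<open>The elements of \<open>U\<close> are served one after the other, each getting
  \<open>n\<close> points of \<open>K\<close> reserved; the last one takes everything that is left.
  As \<open>K\<close> shrinks on the way, the induction generalizes over it.\<close>

lemma even_distribution_exists:
  assumes "finite U" "U \<noteq> {}" "finite K" "card U * n \<le> card K"
  shows "\<exists>g. (\<forall>k. g k \<in> U) \<and> (\<forall>a\<in>U. n \<le> card {k \<in> K. g k = a})"
  using assms
proof (induction U arbitrary: K rule: finite_ne_induct)
  case (singleton x)
  then show ?case by (intro exI[of _ "\<lambda>_. x"]) simp
next
  case (insert x U)
  then have "n \<le> card K" and le: "n + card U * n \<le> card K" by auto
  then obtain K1 where K1: "K1 \<subseteq> K" "card K1 = n" "finite K1"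
    using obtain_subset_with_card_n by metis
  then have "card U * n \<le> card (K - K1)"
    using le by (simp add: card_Diff_subset)
  then obtain g where g: "\<And>k. g k \<in> U" "\<And>a. a \<in> U \<Longrightarrow> n \<le> card {k \<in> K - K1. g k = a}"
    using insert.IH[of "K - K1"] insert.prems by auto
  define h where "h = (\<lambda>k. if k \<in> K1 then x else g k)"
  have "n \<le> card {k \<in> K. h k = a}" if a: "a \<in> insert x U" for a
  proof (cases "a = x")
    case True
    have "K1 \<subseteq> {k \<in> K. h k = a}"
      using K1 True by (auto simp: h_def)
    then show ?thesis
      using card_mono[of "{k \<in> K. h k = a}" K1] K1 insert.prems by simp
  next
    case False
    then have "{k \<in> K. h k = a} = {k \<in> K - K1. g k = a}"
      by (auto simp: h_def)
    then show ?thesis using g False a by simp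
  qed
  moreover have "\<forall>k. h k \<in> insert x U"
    using g by (simp add: h_def)
  ultimately show ?case by blast
qed

section \<open>From the game without duplicating to the MS game\<close>

lemma place_inject: "place a p = place b q \<longleftrightarrow> a = b \<and> p = q"
  by (auto simp: place_def prod_eq_iff)

text \<open>A legal Duplicator move needs an element to pebble in every structure on her
  side.\<close>

definition nonempty_universes :: "('r, 'c, 'a) pebbled set \<Rightarrow> bool" where
  "nonempty_universes X \<longleftrightarrow> (\<forall>p\<in>X. univ (fst p) \<noteq> {})"

text \<open>All copies of \<open>p\<close> receive the pebble that Spoiler puts on \<open>p\<close>.
  Only an inclusion is maintained, which suffices because a matching pair persists in larger
  sets.\<close>

lemma place_each_uniform:
  assumes "fst ` M \<subseteq> X" "place_each X X'"
  shows "\<exists>M'. place_each_copy M M' \<and> fst ` M' \<subseteq> X'"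
proof -
  obtain f where f: "\<forall>p\<in>X. f p \<in> univ (fst p)" "X' = (\<lambda>p. place (f p) p) ` X"
    using assms(2) unfolding place_each_def by blast
  let ?M = "(\<lambda>(p, k). (place (f p) p, k)) ` M"
  have "place_each_copy M ?M"
    unfolding place_each_copy_def
    using f assms(1) by (intro exI[of _ "\<lambda>(p, k). f p"]) force
  moreover have "fst ` ?M \<subseteq> X'"
    using f assms(1) by force
  ultimately show ?thesis by blast
qed

text \<open>Pebbling every element of every universe covers whatever the single copies do.\<close>

lemma copy_and_place_everywhere:
  assumes "fst ` M \<subseteq> X" "nonempty_universes X" "place_each_copy M M'"
  shows "\<exists>X'. copy_and_place X X' \<and> fst ` M' \<subseteq> X' \<and> nonempty_universes X'"
proof -
  let ?X = "{place a p | p a. p \<in> X \<and> a \<in> univ (fst p)}"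
  have "copy_and_place X ?X"
    unfolding copy_and_place_def using assms(2)
    by (intro exI[of _ "\<lambda>p. univ (fst p)"]) (auto simp: nonempty_universes_def)
  moreover have "fst ` M' \<subseteq> ?X"
    using assms(1,3) unfolding place_each_copy_def by fastforce
  moreover have "nonempty_universes ?X"
    using assms(2) by (auto simp: nonempty_universes_def place_def)
  ultimately show ?thesis by blast
qed

lemma place_each_nonempty:
  assumes "nonempty_universes X" "place_each X X'"
  shows "nonempty_universes X'"
  using assms by (auto simp: nonempty_universes_def place_each_def place_def)

section \<open>From the MS game to the game without duplicating\<close>

text \<open>The invariant with \<open>s\<close> rounds left. \<open>M\<close> may contain copies of
  pebbled structures outside \<open>X\<close>, left behind by earlier Spoiler moves; they still have
  to be pebbled, so their universes must be nonempty.\<close>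

definition many_copies ::
  "nat \<Rightarrow> ('r, 'c, 'a) pebbled set \<Rightarrow> (('r, 'c, 'a) pebbled \<times> nat) set \<Rightarrow> bool" where
  "many_copies s X M \<longleftrightarrow> nonempty_universes (fst ` M) \<and>
     (\<forall>p\<in>X. finite (univ (fst p)) \<and> univ (fst p) \<noteq> {} \<and> finite {k. (p, k) \<in> M} \<and>
       card (univ (fst p)) ^ s \<le> card {k. (p, k) \<in> M})"

lemma many_copiesD:
  assumes "many_copies s X M" "p \<in> X"
  shows "finite (univ (fst p))" "univ (fst p) \<noteq> {}" "finite {k. (p, k) \<in> M}"
    "card (univ (fst p)) ^ s \<le> card {k. (p, k) \<in> M}"
  using assms by (auto simp: many_copies_def)

text \<open>Tags are kept and \<open>place\<close> is injective, so the copies of the new pebbled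
  structure are exactly the old copies of \<open>p\<close> that received \<open>a\<close>.\<close>

lemma fibre_after_placing:
  "{k. (place a p, k) \<in> (\<lambda>(p, k). (place (f (p, k)) p, k)) ` M} =
     {k \<in> {k. (p, k) \<in> M}. f (p, k) = a}"
  by (force simp: place_inject image_iff)

text \<open>The required number of copies is positive even for \<open>s = 0\<close>, so a matching
  pair in the simulated position has copies in the multisets.\<close>

lemma many_copies_subset:
  assumes "many_copies s X M"
  shows "X \<subseteq> fst ` M"
proof
  fix p assume "p \<in> X"
  note D = many_copiesD[OF assms this]
  have "0 < card (univ (fst p)) ^ s" using D(1,2) by (simp add: card_gt_0_iff)
  then have "{k. (p, k) \<in> M} \<noteq> {}" using D(4) by (metis card.empty not_le)
  then show "p \<in> fst ` M" by force
qed

lemma many_copies_spoiler: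
  assumes M: "many_copies (Suc s) X M" and "place_each_copy M M'"
  shows "\<exists>X'. place_each X X' \<and> many_copies s X' M'"
proof -
  obtain f where f_all: "\<forall>(p, k)\<in>M. f (p, k) \<in> univ (fst p)"
    and M': "M' = (\<lambda>(p, k). (place (f (p, k)) p, k)) ` M"
    using assms(2) unfolding place_each_copy_def by blast
  have f: "f (p, k) \<in> univ (fst p)" if "(p, k) \<in> M" for p k
    using f_all that by fast
  have "\<exists>a\<in>univ (fst p). card (univ (fst p)) ^ s \<le> card {k \<in> {k. (p, k) \<in> M}. f (p, k) = a}"
    if "p \<in> X" for p
    using many_copiesD[OF M that] f[of p] by (intro large_fibre_exists) auto
  then obtain g where g: "\<And>p. p \<in> X \<Longrightarrow> g p \<in> univ (fst p)"
      "\<And>p. p \<in> X \<Longrightarrow>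
        card (univ (fst p)) ^ s \<le> card {k \<in> {k. (p, k) \<in> M}. f (p, k) = g p}"
    using bchoice[of X "\<lambda>p a. a \<in> univ (fst p) \<and>
      card (univ (fst p)) ^ s \<le> card {k \<in> {k. (p, k) \<in> M}. f (p, k) = a}"] by blast
  \<comment> \<open>\<open>g p\<close> is an element chosen on enough copies of \<open>p\<close>;
    copies pebbled elsewhere remain in \<open>M'\<close> but are not represented in the simulated
    position.\<close>
  let ?X = "(\<lambda>p. place (g p) p) ` X"
  have "place_each X ?X"
    unfolding place_each_def using g by blast
  moreover have "nonempty_universes (fst ` M')"
    using M unfolding M' by (force simp: many_copies_def nonempty_universes_def place_def)
  then have "many_copies s ?X M'"
    unfolding many_copies_def M' ball_simps fibre_after_placing
    using many_copiesD[OF M] g(2) by (simp add: place_def)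
  ultimately show ?thesis by blast
qed

text \<open>The copies of \<open>p\<close> are spread evenly over the whole universe, so every
  element of \<open>G p\<close> gets its share: \<open>card U ^ Suc s\<close> copies split into
  \<open>card U\<close> groups of at least \<open>card U ^ s\<close>.\<close>

lemma many_copies_duplicator:
  assumes M: "many_copies (Suc s) X M" and "copy_and_place X X'"
  shows "\<exists>M'. place_each_copy M M' \<and> many_copies s X' M'"
proof -
  obtain G where G: "\<And>p. p \<in> X \<Longrightarrow> G p \<subseteq> univ (fst p)"
    and X': "X' = {place a p | p a. p \<in> X \<and> a \<in> G p}"
    using assms(2) unfolding copy_and_place_def by blast
  have "\<exists>g. (\<forall>k. (p, k) \<in> M \<longrightarrow> g k \<in> univ (fst p)) \<and> (p \<in> X \<longrightarrow> (\<forall>a\<in>univ (fst p).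
      card (univ (fst p)) ^ s \<le> card {k \<in> {k. (p, k) \<in> M}. g k = a}))" for p
  proof (cases "p \<in> X")
    case True
    then show ?thesis
      using even_distribution_exists[of "univ (fst p)" "{k. (p, k) \<in> M}"
          "card (univ (fst p)) ^ s"] many_copiesD[OF M True] by auto
  next
    case False
    \<comment> \<open>A copy that is not being tracked gets its pebble on an arbitrary
      element.\<close>
    have "(p, k) \<in> M \<Longrightarrow> (SOME a. a \<in> univ (fst p)) \<in> univ (fst p)" for k
      using M by (force simp: many_copies_def nonempty_universes_def some_in_eq)
    then show ?thesis using False by (intro exI[of _ "\<lambda>_. SOME a. a \<in> univ (fst p)"]) auto
  qed
  then obtain g where g: "\<And>p k. (p, k) \<in> M \<Longrightarrow> g p k \<in> univ (fst p)"
      "\<And>p a. \<lbrakk>p \<in> X; a \<in> univ (fst p)\<rbrakk> \<Longrightarrow>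
        card (univ (fst p)) ^ s \<le> card {k \<in> {k. (p, k) \<in> M}. g p k = a}"
    by (elim choice[OF allI, elim_format] exE) blast
  define f where "f = (\<lambda>(p, k). g p k)"
  define M' where "M' = (\<lambda>(p, k). (place (f (p, k)) p, k)) ` M"
  have "place_each_copy M M'"
    unfolding place_each_copy_def M'_def using g(1) by (intro exI[of _ f]) (auto simp: f_def)
  moreover have "nonempty_universes (fst ` M')"
    using M unfolding M'_def by (force simp: many_copies_def nonempty_universes_def place_def)
  moreover have "finite (univ (fst q)) \<and> univ (fst q) \<noteq> {} \<and> finite {k. (q, k) \<in> M'} \<and>
      card (univ (fst q)) ^ s \<le> card {k. (q, k) \<in> M'}" if "q \<in> X'" for q
  proof -
    obtain p a where q: "q = place a p" and p: "p \<in> X" and a: "a \<in> univ (fst p)"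
      using \<open>q \<in> X'\<close> G unfolding X' by blast
    show ?thesis
      unfolding q M'_def fibre_after_placing
      using many_copiesD[OF M p] g(2)[OF p a] by (simp add: place_def f_def)
  qed
  ultimately show ?thesis unfolding many_copies_def by blast
qed

lemma many_copies_initial:
  assumes "\<forall>A\<in>\<A>. finite_structure \<tau> A"
  shows "many_copies r ((\<lambda>A. (A, [])) ` \<A>) ((\<lambda>(A, k). ((A, []), k)) ` copies r \<A>)"
proof -
  have fibre: "{k. ((A, []), k) \<in> (\<lambda>(A, k). ((A, []), k)) ` copies r \<A>} =
      {..<card (univ A) ^ r}" if "A \<in> \<A>" for A
    using that by (auto simp: copies_def image_iff)
  have "finite (univ A)" "univ A \<noteq> {}" if "A \<in> \<A>" for A
    using assms that by (auto simp: finite_structure_def is_structure_def)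
  moreover from this
  have "nonempty_universes (fst ` (\<lambda>(A, k). ((A, []), k)) ` copies r \<A>)"
    by (auto simp: nonempty_universes_def copies_def)
  ultimately show ?thesis
    unfolding many_copies_def ball_simps by (simp add: fibre)
qed

section \<open>Both directions of the equivalence\<close>

lemma matching_exists_mono:
  assumes "matching_exists \<tau> (X, Y)" "X \<subseteq> X'" "Y \<subseteq> Y'"
  shows "matching_exists \<tau> (X', Y')"
  using assms by (auto simp: matching_exists_def)

theorem theorem3p5:
  fixes \<tau> :: "('r, 'c) schema" and r :: nat
    and \<A> \<B> :: "('r, 'c, 'a) struct set"
  assumes "finite_schema \<tau>"
    and "\<forall>A\<in>\<A>. finite_structure \<tau> A"
    and "\<forall>B\<in>\<B>. finite_structure \<tau> B"
  shows "duplicator_wins_MS \<tau> r \<A> \<B> \<longleftrightarrow>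
         duplicator_wins_nodup \<tau> r (copies r \<A>) (copies r \<B>)"
proof
  assume "duplicator_wins_MS \<tau> r \<A> \<B>"
  then show "duplicator_wins_nodup \<tau> r (copies r \<A>) (copies r \<B>)"
    unfolding duplicator_wins_MS_def duplicator_wins_nodup_def
  proof (rule duplicator_wins_transfer[where E = many_copies, rotated -1])
    show "(\<lambda>(X, Y). matching_exists \<tau> (fst ` X, fst ` Y)) (M, N)"
      if "many_copies s X M" "many_copies s Y N" "matching_exists \<tau> (X, Y)"
      for s X Y and M N :: "(('r, 'c, 'a) pebbled \<times> nat) set"
      using matching_exists_mono[OF that(3)] that(1,2)[THEN many_copies_subset] by simp
  qed (use assms(2,3) in \<open>blast intro: many_copies_spoiler many_copies_duplicator
      many_copies_initial\<close>)+
next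
  \<comment> \<open>Here the game without duplicating is the one known to be won. Inclusion survives
    each round without loss, so one relation serves at every stage.\<close>
  let ?E = "\<lambda>(_ :: nat) (M :: (('r, 'c, 'a) pebbled \<times> nat) set) X.
    fst ` M \<subseteq> X \<and> nonempty_universes X"
  have initial: "?E r ((\<lambda>(A, k). ((A, []), k)) ` copies r \<C>) ((\<lambda>A. (A, [])) ` \<C>)"
    if "\<forall>A\<in>\<C>. finite_structure \<tau> A" for \<C> :: "('r, 'c, 'a) struct set"
    using that
    by (auto simp: copies_def nonempty_universes_def finite_structure_def is_structure_def)
  assume "duplicator_wins_nodup \<tau> r (copies r \<A>) (copies r \<B>)"
  then show "duplicator_wins_MS \<tau> r \<A> \<B>"
    unfolding duplicator_wins_MS_def duplicator_wins_nodup_def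
  proof (rule duplicator_wins_transfer[where E = ?E, rotated -1])
    show "\<exists>M'. place_each_copy M M' \<and> ?E s M' X'"
      if "?E (Suc s) M X" "place_each X X'" for s M X X'
      using place_each_uniform[of M X X'] place_each_nonempty[of X X'] that by blast
    show "\<exists>X'. copy_and_place X X' \<and> ?E s M' X'"
      if "?E (Suc s) M X" "place_each_copy M M'" for s M X M'
      using copy_and_place_everywhere[of M X M'] that by blast
    show "matching_exists \<tau> (X, Y)"
      if "?E s M X" "?E s N Y" "(\<lambda>(X, Y). matching_exists \<tau> (fst ` X, fst ` Y)) (M, N)"
      for s M N X Y
      using that matching_exists_mono by auto
  qed (use initial assms(2,3) in blast)+
qed

end
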